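(* Let $(\mathcal{P})$ be the mixed-integer nonlinear program with multilinear interpolation constraints defined in the context, with feasible region $P$, and suppose global solvers for MILP and NLP as described in the context are available. Then the Relax-Fix-and-Exclude algorithm described in the context, applied to $(\mathcal{P})$, terminates in a finite number of steps and returns either (i) $\infty$, if $(\mathcal{P})$ is infeasible, (ii) $-\infty$, if $(\mathcal{P})$ is unbounded, or (iii) an optimal solution $(\boldsymbol{\xi}^\star,\boldsymbol{y}^\star)$ of $(\mathcal{P})$.
   Context: **Data.** Let $n\ge 1$, $m,p\ge 0$ be integers and let $X\subseteq\mathbb{R}^n$ be a polyhedron. For each $j=1,\dots,n$ let $\mathcal{B}_j=\{\hat x_j^k\}_{k\in\mathcal{I}_j}\subset\mathbb{R}$ be a finite set of breakpoints with index set $\mathcal{I}_j=\{0,1,\dots,K_j\}$ and $\hat x_j^0<\hat x_j^1<\cdots<\hat x_j^{K_j}$. Put $\mathcal{B}=\mathcal{B}_1\times\cdots\times\mathcal{B}_n\subseteq X$, $\mathcal{I}=\mathcal{I}_1\times\cdots\times\mathcal{I}_n$, and $\hat{\boldsymbol{x}}^{\boldsymbol{k}}=(\hat x_1^{k_1},\dots,\hat x_n^{k_n})$ for $\boldsymbol{k}=(k_1,\dots,k_n)\in\mathcal{I}$. For $i=0,\dots,m$ the real values $f_i(\hat{\boldsymbol{x}}^{\boldsymbol{k}})$, $\boldsymbol{k}\in\mathcal{I}$, are given (look-up tables). Also given are vectors $\boldsymbol{c},\boldsymbol{a}_1,\dots,\boldsymbol{a}_m\in\mathbb{R}^p$ and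 scalars $b_1,\dots,b_m\in\mathbb{R}$. **SOS2.** A vector $\boldsymbol{v}\in\mathbb{R}^{\mathcal{I}_j}$ satisfies $\boldsymbol{v}\in\mathrm{SOS2}(\mathcal{I}_j)$ if at most two of its entries are nonzero and, if two entries are nonzero, their indices are consecutive in $\mathcal{I}_j$. **Problem $(\mathcal{P})$.** Minimize $\widetilde f_0+\boldsymbol{c}^T\boldsymbol{y}$ over $(\boldsymbol{\xi},\boldsymbol{y})$, with $\boldsymbol{\xi}=(\boldsymbol{\xi}^1,\dots,\boldsymbol{\xi}^n)$, $\boldsymbol{\xi}^j\in\mathbb{R}^{\mathcal{I}_j}$, subject to - $\widetilde f_i+\boldsymbol{a}_i^T\boldsymbol{y}\le b_i$ for $i=1,\dots,m$; - $\widetilde f_i=\sum_{\boldsymbol{k}\in\mathcal{I}}\lambda_{\boldsymbol{k}}f_i(\hat{\boldsymbol{x}}^{\boldsymbol{k}})$ for $i=0,\dots,m$; - $\lambda_{\boldsymbol{k}}=\prod_{j=1}^n\xi^j_{k_j}$ for all $\boldsymbol{k}\in\mathcal{I}$; - $x_j=\sum_{k\in\mathcal{I}_j}\xi^j_k\hat x_j^k$, $\sum_{k\in\mathcal{I}_j}\xi^j_k=1$, $\boldsymbol{\xi}^j\in\mathrm{SOS2}(\mathcal{I}_j)$, $\boldsymbol{\xi}^j\ge\boldsymbol{0}$ for $j=1,\dots,n$; - $\boldsymbol{x}\in X$, $\boldsymbol{y}\in\{0,1\}^p$. The variables $\boldsymbol{x},\boldsymbol{\lambda},\widetilde{\boldsymbol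 f}$ are functions of $\boldsymbol{\xi}$, so the feasible region $P$ is regarded as a set of pairs $(\boldsymbol{\xi},\boldsymbol{y})$. **MILP relaxation $(\overline{\mathcal{P}})$.** Minimize $\widetilde f_0+\boldsymbol{c}^T\boldsymbol{y}$ over $(\boldsymbol{\xi},\boldsymbol{\lambda},\boldsymbol{y})$, with $\boldsymbol{\lambda}\in[0,1]^{\mathcal{I}}$, subject to the same constraints as $(\mathcal{P})$ except that the product constraints $\lambda_{\boldsymbol{k}}=\prod_j\xi^j_{k_j}$ are replaced by $$\xi^j_{\hat k}=\sum_{\boldsymbol{k}\in\mathcal{I}:\,k_j=\hat k}\lambda_{\boldsymbol{k}}\qquad\text{for all }\hat k\in\mathcal{I}_j,\ j=1,\dots,n.$$ The SOS2 constraints in $(\overline{\mathcal{P}})$ are formulated with auxiliary binary vectors: $\boldsymbol{\xi}^j\le\boldsymbol{\zeta}^j$, $\boldsymbol{\zeta}^j\in\{0,1\}^{\mathcal{I}_j}\cap\mathrm{SOS2}(\mathcal{I}_j)$, $j=1,\dots,n$. The (current) feasible region of $(\overline{\mathcal{P}})$ is denoted $\overline P$. **NLP subproblems (fixing).** For binary $\overline{\boldsymbol{\zeta}}=(\overline{\boldsymbol{\zeta}}^1,\dots,\overline{\boldsymbol{\zeta}}^n)$ with $\overline{\boldsymbol{\zeta}}^j\in\mathrm{SOS2}(\mathcal{I}_j)$, and $\overline{\boldsymbol{y}}\in\{0,1\}^p$, let $$P(\overline{\boldsymbol{\zeta}},\overline{\boldsymbol{y}})=\{(\boldsymbol{\xi},\boldsymbol{y})\in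 P:\ \boldsymbol{y}=\overline{\boldsymbol{y}},\ \boldsymbol{\xi}^j\le\overline{\boldsymbol{\zeta}}^j,\ j=1,\dots,n\}.$$ The NLP subproblem is to minimize the objective of $(\mathcal{P})$ over this set. $\lceil\boldsymbol{\xi}\rceil$ denotes the entrywise ceiling. **Exclusion cut.** For given $\overline{\boldsymbol{\xi}},\overline{\boldsymbol{y}}$ it is the inequality $$\sum_{j=1}^n\sum_{k\in\mathcal{I}_j}\bigl(1-\lceil\overline\xi^j_k\rceil\bigr)\zeta^j_k+\sum_{l=1}^p\bigl\{\overline y_l(1-y_l)+(1-\overline y_l)y_l\bigr\}\ge 1 .$$ **Solvers.** Global solvers for MILP and NLP are assumed available: given a problem they return an optimal solution and its cost, or the cost $\infty$ if the problem is infeasible, or the cost $-\infty$ if it is unbounded. **Relax-Fix-and-Exclude algorithm.** 1. Set $C\gets\infty$. 2. Solve the MILP relaxation: find an optimal solution $(\overline{\boldsymbol{\xi}},\overline{\boldsymbol{\lambda}},\overline{\boldsymbol{y}})\in\overline P$ with cost $\overline C$. 3. While $\overline C<C$ (this test is false when both are $\infty$): (a) (Fix) Solve the NLP subproblem: find an optimal solution $(\widetilde{\boldsymbol{\xi}},\widetilde{\boldsymbol{y}})\in P(\lceil\overline{\boldsymbol{\xi}}\rceil,\overline{\boldsymbol{y}})$ with cost $\widetilde C$. (b) If $\widetilde C<C$, set $C\gets\widetilde C$ and $(\boldsymbol{\xi}^\star,\boldsymbol{y}^\star)\gets(\widetilde{\boldsymbol{\xi}},\widetilde{\boldsymbol{y}})$.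 (c) (Exclude) Add to the constraints defining $\overline P$ the exclusion cut for $\lceil\overline{\boldsymbol{\xi}}\rceil$ and $\overline{\boldsymbol{y}}$. (d) Solve the restricted MILP relaxation: update the optimal solution $(\overline{\boldsymbol{\xi}},\overline{\boldsymbol{\lambda}},\overline{\boldsymbol{y}})\in\overline P$ and its cost $\overline C$. 4. If $|C|<\infty$, return $(\boldsymbol{\xi}^\star,\boldsymbol{y}^\star)$; otherwise return $C$.
   Formalization: As printed the algorithm can loop forever, since a relaxation optimum may recur with a larger ζ; here, when the ceiling of ξ̄ with ȳ already violates an earlier exclusion cut, the binary vector ζ of the MILP solution is used instead of the ceiling for fixing and excluding. *)

theory Defs
  imports "HOL-Analysis.Analysis"
begin

text \<open>
  The dimension n of the interpolation domain is the cardinality of the finite type 'n (so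
  n is at least 1), and an index j = 1, ..., n is an element of 'n.  The numbers m and p may be 0,
  so constraints and binary variables are indexed by \<open>{1..m}\<close> and \<open>{1..p}\<close> inside \<open>nat\<close>.
  A vector of \<open>\<real>\<^sup>I\<close> is a function that vanishes outside I.
  The table \<open>fn i\<close> is only ever evaluated at grid points, and index 0 is the objective.
\<close>

record ('n::finite) minlp =
  Xdom :: "(real^'n) set"
  Kmax :: "'n \<Rightarrow> nat"
  bp :: "'n \<Rightarrow> nat \<Rightarrow> real"
  mnum :: nat
  pnum :: nat
  fn :: "nat \<Rightarrow> real^'n \<Rightarrow> real"
  cvec :: "nat \<Rightarrow> real"
  avec :: "nat \<Rightarrow> nat \<Rightarrow> real"
  bval :: "nat \<Rightarrow> real"

type_synonym 'n xi = "'n \<Rightarrow> nat \<Rightarrow> real"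
type_synonym 'n lam = "('n \<Rightarrow> nat) \<Rightarrow> real"
type_synonym yvec = "nat \<Rightarrow> real"

definition idx :: "('n::finite) minlp \<Rightarrow> 'n \<Rightarrow> nat set" where
  "idx D j = {0..Kmax D j}"

definition midx :: "('n::finite) minlp \<Rightarrow> ('n \<Rightarrow> nat) set" where
  "midx D = {k. \<forall>j. k j \<in> idx D j}"

definition grid :: "('n::finite) minlp \<Rightarrow> ('n \<Rightarrow> nat) \<Rightarrow> real^'n" where
  "grid D k = (\<chi> j. bp D j (k j))"

definition valid_data :: "('n::finite) minlp \<Rightarrow> bool" where
  "valid_data D \<longleftrightarrow>
     polyhedron (Xdom D) \<and>
     (\<forall>j. strict_mono_on (idx D j) (bp D j)) \<and>
     grid D ` midx D \<subseteq> Xdom D"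

definition vec_on :: "'i set \<Rightarrow> ('i \<Rightarrow> real) \<Rightarrow> bool" where
  "vec_on I v \<longleftrightarrow> (\<forall>k. k \<notin> I \<longrightarrow> v k = 0)"

definition binary_on :: "'i set \<Rightarrow> ('i \<Rightarrow> real) \<Rightarrow> bool" where
  "binary_on I v \<longleftrightarrow> vec_on I v \<and> (\<forall>k\<in>I. v k \<in> {0, 1})"

definition sos2 :: "nat set \<Rightarrow> (nat \<Rightarrow> real) \<Rightarrow> bool" where
  "sos2 I v \<longleftrightarrow>
     card {k\<in>I. v k \<noteq> 0} \<le> 2 \<and>
     (\<forall>k\<in>I. \<forall>l\<in>I. k < l \<and> v k \<noteq> 0 \<and> v l \<noteq> 0 \<longrightarrow> l = Suc k)"

definition ftilde :: "('n::finite) minlp \<Rightarrow> 'n lam \<Rightarrow> nat \<Rightarrow> real" where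
  "ftilde D lam i = (\<Sum>k\<in>midx D. lam k * fn D i (grid D k))"

definition xpoint :: "('n::finite) minlp \<Rightarrow> 'n xi \<Rightarrow> real^'n" where
  "xpoint D xi = (\<chi> j. \<Sum>k\<in>idx D j. xi j k * bp D j k)"

definition prod_weights :: "('n::finite) xi \<Rightarrow> 'n lam" where
  "prod_weights xi = (\<lambda>k. \<Prod>j\<in>UNIV. xi j (k j))"

definition dotp :: "('n::finite) minlp \<Rightarrow> (nat \<Rightarrow> real) \<Rightarrow> yvec \<Rightarrow> real" where
  "dotp D u y = (\<Sum>l=1..pnum D. u l * y l)"

definition cost :: "('n::finite) minlp \<Rightarrow> 'n lam \<Rightarrow> yvec \<Rightarrow> real" where
  "cost D lam y = ftilde D lam 0 + dotp D (cvec D) y"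

text \<open>The constraints shared by the problem and its relaxation, i.e. all except those linking
  \<open>xi\<close> to \<open>lam\<close> and the SOS2 constraints.\<close>

definition common_constraints :: "('n::finite) minlp \<Rightarrow> 'n xi \<Rightarrow> 'n lam \<Rightarrow> yvec \<Rightarrow> bool" where
  "common_constraints D xi lam y \<longleftrightarrow>
     (\<forall>i\<in>{1..mnum D}. ftilde D lam i + dotp D (avec D i) y \<le> bval D i) \<and>
     (\<forall>j. vec_on (idx D j) (xi j) \<and>
          (\<Sum>k\<in>idx D j. xi j k) = 1 \<and>
          (\<forall>k\<in>idx D j. 0 \<le> xi j k)) \<and>
     xpoint D xi \<in> Xdom D \<and>
     binary_on {1..pnum D} y"

definition P_region :: "('n::finite) minlp \<Rightarrow> ('n xi \<times> yvec) set" where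
  "P_region D =
     {(xi, y). common_constraints D xi (prod_weights xi) y \<and> (\<forall>j. sos2 (idx D j) (xi j))}"

definition P_cost :: "('n::finite) minlp \<Rightarrow> 'n xi \<times> yvec \<Rightarrow> real" where
  "P_cost D = (\<lambda>(xi, y). cost D (prod_weights xi) y)"

definition P_fixed :: "('n::finite) minlp \<Rightarrow> 'n xi \<Rightarrow> yvec \<Rightarrow> ('n xi \<times> yvec) set" where
  "P_fixed D z0 y0 =
     {(xi, y) \<in> P_region D. y = y0 \<and> (\<forall>j. \<forall>k\<in>idx D j. xi j k \<le> z0 j k)}"

definition ceil_xi :: "'n xi \<Rightarrow> 'n xi" where
  "ceil_xi xi = (\<lambda>j k. of_int \<lceil>xi j k\<rceil>)"

definition exclusion_cut ::
    "('n::finite) minlp \<Rightarrow> 'n xi \<times> yvec \<Rightarrow> 'n xi \<Rightarrow> yvec \<Rightarrow> bool" where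
  "exclusion_cut D = (\<lambda>(z0, y0) z y.
     (\<Sum>j\<in>UNIV. \<Sum>k\<in>idx D j. (1 - z0 j k) * z j k) +
     (\<Sum>l=1..pnum D. y0 l * (1 - y l) + (1 - y0 l) * y l) \<ge> 1)"

type_synonym 'n relax_point = "'n xi \<times> 'n lam \<times> 'n xi \<times> yvec"

text \<open>Points of the relaxation are \<open>(xi, lam, z, y)\<close>, where \<open>z\<close> is the auxiliary
  binary vector that encodes SOS2; \<open>cuts\<close> lists the exclusion cuts added so far.\<close>

definition R_region :: "('n::finite) minlp \<Rightarrow> ('n xi \<times> yvec) list \<Rightarrow> 'n relax_point set" where
  "R_region D cuts =
     {(xi, lam, z, y).
        common_constraints D xi lam y \<and>
        vec_on (midx D) lam \<and> (\<forall>k\<in>midx D. 0 \<le> lam k \<and> lam k \<le> 1) \<and>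
        (\<forall>j. \<forall>h\<in>idx D j. xi j h = (\<Sum>k\<in>{k\<in>midx D. k j = h}. lam k)) \<and>
        (\<forall>j. binary_on (idx D j) (z j) \<and> sos2 (idx D j) (z j) \<and>
             (\<forall>k\<in>idx D j. xi j k \<le> z j k)) \<and>
        (\<forall>q\<in>set cuts. exclusion_cut D q z y)}"

definition R_cost :: "('n::finite) minlp \<Rightarrow> 'n relax_point \<Rightarrow> real" where
  "R_cost D = (\<lambda>(xi, lam, z, y). cost D lam y)"

definition minimizer :: "('a \<Rightarrow> real) \<Rightarrow> 'a set \<Rightarrow> 'a \<Rightarrow> bool" where
  "minimizer g S s \<longleftrightarrow> s \<in> S \<and> (\<forall>t\<in>S. g s \<le> g t)"

definition unbounded_problem :: "('a \<Rightarrow> real) \<Rightarrow> 'a set \<Rightarrow> bool" where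
  "unbounded_problem g S \<longleftrightarrow> (\<forall>B. \<exists>s\<in>S. g s < B)"

definition correct_answer :: "('a \<Rightarrow> real) \<Rightarrow> 'a set \<Rightarrow> 'a option \<times> ereal \<Rightarrow> bool" where
  "correct_answer g S = (\<lambda>(sol, C).
     (\<exists>s. sol = Some s \<and> minimizer g S s \<and> C = ereal (g s)) \<or>
     (sol = None \<and> S = {} \<and> C = \<infinity>) \<or>
     (sol = None \<and> unbounded_problem g S \<and> C = -\<infinity>))"

text \<open>A solver is a relation, so that it may pick any optimal solution and need not be
  deterministic.  On each problem of the class \<open>Q\<close> its answers must be correct, and it must
  answer whenever a correct answer exists.  Nothing is demanded if the infimum is finite but not
  attained; that this does not happen here is not assumed.\<close>

type_synonym 'a solver = "('a \<Rightarrow> real) \<Rightarrow> 'a set \<Rightarrow> 'a option \<times> ereal \<Rightarrow> bool"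

definition global_solver :: "(('a \<Rightarrow> real) \<times> 'a set) set \<Rightarrow> 'a solver \<Rightarrow> bool" where
  "global_solver Q solve \<longleftrightarrow> (\<forall>(g, S) \<in> Q.
     (\<forall>r. solve g S r \<longrightarrow> correct_answer g S r) \<and>
     ((\<exists>r. correct_answer g S r) \<longrightarrow> (\<exists>r. solve g S r)))"

definition MILP_problems ::
    "('n::finite) minlp \<Rightarrow> (('n relax_point \<Rightarrow> real) \<times> 'n relax_point set) set" where
  "MILP_problems D = {(R_cost D, R_region D cuts) | cuts. True}"

definition NLP_problems ::
    "('n::finite) minlp \<Rightarrow> (('n xi \<times> yvec \<Rightarrow> real) \<times> ('n xi \<times> yvec) set) set" where
  "NLP_problems D =
     {(P_cost D, P_fixed D z0 y0) | z0 y0.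
        (\<forall>j. binary_on (idx D j) (z0 j) \<and> sos2 (idx D j) (z0 j)) \<and> binary_on {1..pnum D} y0}"

text \<open>This is the state at the loop test, just after a call of the MILP solver, whose answer is
  stored in the last two fields.\<close>

record ('n::finite) rfe_state =
  best_cost :: ereal
  incumbent :: "('n xi \<times> yvec) option"
  cut_list :: "('n xi \<times> yvec) list"
  relax_sol :: "'n relax_point option"
  relax_cost :: ereal

text \<open>
  The binary vector used to fix and to exclude is the entrywise ceiling of the relaxed \<open>xi\<close>.
  The only exception is when this ceiling, together with \<open>y\<close>, already violates an earlier cut
  (which happens if \<open>xi\<close> has only one nonzero entry in some coordinate, and \<open>z\<close> has two).
  Then the cut generated by the ceiling is implied by the earlier one, and its NLP subproblem is a
  restriction of one already solved: fixing and excluding with the ceiling would change neither C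
  nor the relaxation, and the loop would run forever on some instances.  In that case the
  binary vector \<open>z\<close> of the MILP solution itself is used.
\<close>

definition fix_vector ::
    "('n::finite) minlp \<Rightarrow> ('n xi \<times> yvec) list \<Rightarrow> 'n relax_point \<Rightarrow> 'n xi" where
  "fix_vector D cuts = (\<lambda>(xi, lam, z, y).
     if \<forall>q\<in>set cuts. exclusion_cut D q (ceil_xi xi) y then ceil_xi xi else z)"

inductive rfe_init ::
    "('n::finite) minlp \<Rightarrow> 'n relax_point solver \<Rightarrow> 'n rfe_state \<Rightarrow> bool"
  for D milp where
  "milp (R_cost D) (R_region D []) (sol, Cbar) \<Longrightarrow>
   rfe_init D milp \<lparr>best_cost = \<infinity>, incumbent = None, cut_list = [],
                    relax_sol = sol, relax_cost = Cbar\<rparr>"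

definition loop_test :: "('n::finite) rfe_state \<Rightarrow> bool" where
  "loop_test s \<longleftrightarrow> relax_cost s < best_cost s"

text \<open>There is no step from a state in which the loop test holds but the MILP solver has
  returned no solution (unbounded relaxation); \<open>rfe_terminates\<close> below excludes this.\<close>

inductive rfe_step ::
    "('n::finite) minlp \<Rightarrow> 'n relax_point solver \<Rightarrow> ('n xi \<times> yvec) solver \<Rightarrow>
     'n rfe_state \<Rightarrow> 'n rfe_state \<Rightarrow> bool"
  for D milp nlp where
  "\<lbrakk>loop_test s;
    relax_sol s = Some (xi, lam, z, y);
    w = fix_vector D (cut_list s) (xi, lam, z, y);
    nlp (P_cost D) (P_fixed D w y) (nsol, Ctil);
    (C', inc') = (if Ctil < best_cost s then (Ctil, nsol) else (best_cost s, incumbent s));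
    cuts' = (w, y) # cut_list s;
    milp (R_cost D) (R_region D cuts') (sol', Cbar')\<rbrakk> \<Longrightarrow>
   rfe_step D milp nlp s \<lparr>best_cost = C', incumbent = inc', cut_list = cuts',
                          relax_sol = sol', relax_cost = Cbar'\<rparr>"

definition rfe_reachable ::
    "('n::finite) minlp \<Rightarrow> 'n relax_point solver \<Rightarrow> ('n xi \<times> yvec) solver \<Rightarrow>
     'n rfe_state \<Rightarrow> bool" where
  "rfe_reachable D milp nlp s \<longleftrightarrow>
     (\<exists>s0. rfe_init D milp s0 \<and> (rfe_step D milp nlp)\<^sup>*\<^sup>* s0 s)"

datatype 'n rfe_output = Value ereal | Solution "'n xi" yvec

definition rfe_return :: "('n::finite) rfe_state \<Rightarrow> 'n rfe_output" where
  "rfe_return s =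
     (if \<bar>best_cost s\<bar> < \<infinity> then case the (incumbent s) of (xi, y) \<Rightarrow> Solution xi y
      else Value (best_cost s))"

text \<open>Termination for every behaviour of the solvers: the algorithm can start, there is no
  infinite run, and a run never gets stuck while the loop test holds.\<close>

definition rfe_terminates ::
    "('n::finite) minlp \<Rightarrow> 'n relax_point solver \<Rightarrow> ('n xi \<times> yvec) solver \<Rightarrow> bool" where
  "rfe_terminates D milp nlp \<longleftrightarrow>
     (\<exists>s. rfe_init D milp s) \<and>
     \<not> (\<exists>\<sigma>. rfe_init D milp (\<sigma> 0) \<and> (\<forall>t::nat. rfe_step D milp nlp (\<sigma> t) (\<sigma> (Suc t)))) \<and>
     (\<forall>s. rfe_reachable D milp nlp s \<and> loop_test s \<longrightarrow> (\<exists>s'. rfe_step D milp nlp s s'))"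

end

theory Submission
  imports Defs
begin

text \<open>
  Two observations make the algorithm work.

  All optimization problems that occur have compact feasible regions: the weights lie in
  \<open>[0, 1]\<close>, the remaining variables are binary, and every constraint, SOS2 included, is closed
  (\<open>compact_R_region\<close>, \<open>compact_P_fixed\<close>).  The costs are continuous, so each problem is either
  infeasible or attains a finite minimum.  Hence the solvers always have an answer, the value
  \<open>-\<infinity>\<close> never occurs, and \<open>P\<close> itself cannot be unbounded.

  An exclusion cut, evaluated at binary vectors, compares a number of mismatches with 1.  It
  therefore fails for \<open>(z, y)\<close> exactly if \<open>z \<le> w\<close> and \<open>y = y0\<close>, where \<open>(w, y0)\<close> is the pair that
  generated it (\<open>exclusion_cut_binary_iff\<close>).  This has two consequences.  The pair that generates
  a cut violates it but satisfies all earlier cuts, so it is new; there are only finitely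
  many such pairs, so the loop ends (\<open>fix_vector_new_key\<close>, \<open>no_infinite_run\<close>).  Conversely,
  a feasible point of \<open>P\<close> whose support pattern violates a cut is feasible for the NLP subproblem
  that was solved when the cut was added (\<open>cut_off_point_in_subproblem\<close>), while a point whose
  pattern violates no cut lifts to the current relaxation at the same cost
  (\<open>lift_to_relaxation\<close>).  So every point of \<open>P\<close> costs at least the best known value or at least
  the current relaxation value, and when the loop test fails the former bound follows from
  the latter (\<open>best_cost_optimal\<close>).
\<close>

section \<open>Compact feasible regions and attained minima\<close>

text \<open>Tychonoff: a function type carries the product topology.\<close>

lemma compact_fun_box:
  assumes "\<And>i. compact (S i)"
  shows "compact {f. \<forall>i. f i \<in> S i}"
proof -
  have "compactin (product_topology (\<lambda>i. euclidean) UNIV) (PiE UNIV S)"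
    using assms by (simp add: compactin_PiE)
  moreover have "PiE UNIV S = {f. \<forall>i. f i \<in> S i}"
    by (auto simp: PiE_UNIV_domain)
  ultimately show ?thesis
    by (simp add: euclidean_product_topology)
qed

lemma compact_closed_subset:
  assumes "compact U" "closed S" "S \<subseteq> U"
  shows "compact S"
  using compact_Int_closed[OF assms(1,2)] assms(3) by (simp add: inf.absorb2)

text \<open>The cardinality bound in SOS2 is a consequence of adjacency: of three nonzero entries,
  the outer two could not be adjacent.  What remains is a finite conjunction of
  disjunctions of equations, hence a closed condition.\<close>

lemma sos2_iff_consecutive:
  assumes "finite I"
  shows "sos2 I v \<longleftrightarrow> (\<forall>k\<in>I. \<forall>l\<in>I. k < l \<longrightarrow> l = Suc k \<or> v k = 0 \<or> v l = 0)"
proof -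
  have "card {k\<in>I. v k \<noteq> 0} \<le> 2"
    if c: "\<forall>k\<in>I. \<forall>l\<in>I. k < l \<longrightarrow> l = Suc k \<or> v k = 0 \<or> v l = 0"
  proof (cases "{k\<in>I. v k \<noteq> 0} = {}")
    case False
    define S where "S = {k\<in>I. v k \<noteq> 0}"
    define a where "a = Min S"
    have fin: "finite S" using assms by (simp add: S_def)
    have a: "a \<in> S" using Min_in[OF fin] False by (simp add: S_def a_def)
    have "k \<in> {a, Suc a}" if k: "k \<in> S" for k
    proof (cases "a = k")
      case False
      then have "a < k" using Min_le[OF fin k] by (simp add: a_def)
      then show ?thesis using c a k by (auto simp: S_def)
    qed simp
    then have "card S \<le> card {a, Suc a}"
      by (intro card_mono) auto
    then show ?thesis by (simp add: S_def)
  next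
    case True
    show ?thesis unfolding True by simp
  qed
  then show ?thesis unfolding sos2_def by blast
qed

lemma sos2_support_subset:
  assumes "finite I" "sos2 I z" "\<And>k. k \<in> I \<Longrightarrow> z k = 0 \<Longrightarrow> v k = 0"
  shows "sos2 I v"
  using assms unfolding sos2_iff_consecutive[OF assms(1)] by blast

lemma finite_idx [simp]: "finite (idx D j)"
  by (simp add: idx_def)

lemma binary_on_range:
  assumes "binary_on I v"
  shows "v k = 0 \<or> v k = 1"
  using assms unfolding binary_on_def vec_on_def by blast

lemma closed_binary_on:
  fixes Y :: "'z::topological_space \<Rightarrow> 'i \<Rightarrow> real"
  assumes "\<And>k. continuous_on UNIV (\<lambda>p. Y p k)"
  shows "closed {p. binary_on I (Y p)}"
  unfolding binary_on_def vec_on_def insert_iff empty_iff Ball_def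
  by (intro closed_Collect_conj closed_Collect_all closed_Collect_imp closed_Collect_disj
      closed_Collect_eq open_Collect_const closed_Collect_const assms continuous_intros)

lemma closed_sos2:
  fixes Z :: "'z::topological_space \<Rightarrow> nat \<Rightarrow> real"
  assumes "finite I" "\<And>k. continuous_on UNIV (\<lambda>p. Z p k)"
  shows "closed {p. sos2 I (Z p)}"
  unfolding sos2_iff_consecutive[OF assms(1)] Ball_def
  by (intro closed_Collect_all closed_Collect_imp closed_Collect_disj
      closed_Collect_eq open_Collect_const closed_Collect_const assms continuous_intros)

lemma continuous_cost:
  fixes L :: "'z::topological_space \<Rightarrow> 'n::finite lam"
  assumes "\<And>k. continuous_on UNIV (\<lambda>p. L p k)" "\<And>l. continuous_on UNIV (\<lambda>p. Y p l)"
  shows "continuous_on UNIV (\<lambda>p. cost D (L p) (Y p))"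
  unfolding cost_def ftilde_def dotp_def by (intro continuous_intros assms)

lemma closed_common_constraints:
  fixes X :: "'z::topological_space \<Rightarrow> 'n::finite xi"
  assumes "closed (Xdom D)"
    and "\<And>j k. continuous_on UNIV (\<lambda>p. X p j k)"
    and "\<And>k. continuous_on UNIV (\<lambda>p. L p k)"
    and "\<And>l. continuous_on UNIV (\<lambda>p. Y p l)"
  shows "closed {p. common_constraints D (X p) (L p) (Y p)}"
proof -
  have "continuous_on UNIV (\<lambda>p. xpoint D (X p))"
    unfolding xpoint_def by (intro continuous_intros assms)
  then have "closed {p. xpoint D (X p) \<in> Xdom D}"
    using closed_vimage[OF assms(1)] by (simp add: vimage_def)
  then show ?thesis
    unfolding common_constraints_def ftilde_def dotp_def vec_on_def Ball_def
    by (intro closed_Collect_all closed_Collect_conj closed_Collect_imp closed_Collect_le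
        closed_Collect_eq open_Collect_const closed_binary_on continuous_intros assms)
qed

lemma common_constraints_unit_box:
  assumes "common_constraints D xi lam y"
  shows "xi j k \<in> {0..1}" "y l \<in> {0..1}"
proof -
  have s: "vec_on (idx D j) (xi j)" "(\<Sum>k\<in>idx D j. xi j k) = 1" "\<forall>k\<in>idx D j. 0 \<le> xi j k"
    and y: "binary_on {1..pnum D} y"
    using assms by (auto simp: common_constraints_def)
  show "xi j k \<in> {0..1}"
  proof (cases "k \<in> idx D j")
    case True
    then have "xi j k \<le> (\<Sum>k\<in>idx D j. xi j k)"
      using s by (intro member_le_sum) auto
    then show ?thesis using s True by auto
  qed (use s in \<open>auto simp: vec_on_def\<close>)
  show "y l \<in> {0..1}"
    using binary_on_range[OF y, of l] by auto
qed

lemma compact_unit_boxes: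
  "compact {f :: 'i \<Rightarrow> real. \<forall>i. f i \<in> {0..1}}"
  "compact {f :: 'i \<Rightarrow> 'k \<Rightarrow> real. \<forall>i k. f i k \<in> {0..1}}"
  using compact_fun_box[of "\<lambda>_::'i. {0..1::real}"]
    compact_fun_box[of "\<lambda>_::'i. {f :: 'k \<Rightarrow> real. \<forall>i. f i \<in> {0..1}}"]
    compact_fun_box[of "\<lambda>_::'k. {0..1::real}"]
  by simp_all

text \<open>These are the entries of the components of \<open>(xi, y)\<close> and of \<open>(xi, lam, z, y)\<close>, one rule per
  shape.  A single rule for the entries of a continuous family of functions would apply to
  its own premise and make backward chaining diverge.\<close>

lemmas continuous_entries =
  continuous_on_product_then_coordinatewise[OF
    continuous_on_product_then_coordinatewise[OF continuous_on_fst[OF continuous_on_id]]]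
  continuous_on_product_then_coordinatewise[OF continuous_on_snd[OF continuous_on_id]]
  continuous_on_product_then_coordinatewise[OF
    continuous_on_fst[OF continuous_on_snd[OF continuous_on_id]]]
  continuous_on_product_then_coordinatewise[OF
    continuous_on_product_then_coordinatewise[OF
      continuous_on_fst[OF continuous_on_snd[OF continuous_on_snd[OF continuous_on_id]]]]]
  continuous_on_product_then_coordinatewise[OF
    continuous_on_snd[OF continuous_on_snd[OF continuous_on_snd[OF continuous_on_id]]]]

lemma compact_R_region:
  assumes "closed (Xdom D)"
  shows "compact (R_region D cuts)"
proof -
  let ?U = "{f. \<forall>i k. f i k \<in> {0..1::real}} \<times> {f. \<forall>i. f i \<in> {0..1::real}} \<times>
            {f. \<forall>i k. f i k \<in> {0..1::real}} \<times> {f. \<forall>i. f i \<in> {0..1::real}}"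
  have "compact ?U"
    by (intro compact_Times compact_unit_boxes)
  moreover have "closed (R_region D cuts)"
    unfolding R_region_def exclusion_cut_def vec_on_def Ball_def case_prod_beta
    by (intro closed_Collect_all closed_Collect_conj closed_Collect_imp closed_Collect_le
        closed_Collect_eq open_Collect_const closed_binary_on closed_sos2
        closed_common_constraints assms continuous_entries continuous_intros finite_idx)
  moreover have "R_region D cuts \<subseteq> ?U"
  proof
    fix p assume p: "p \<in> R_region D cuts"
    obtain xi lam z y where eq: "p = (xi, lam, z, y)"
      by (cases p)
    have c: "common_constraints D xi lam y"
      and l: "vec_on (midx D) lam" "\<forall>k\<in>midx D. 0 \<le> lam k \<and> lam k \<le> 1"
      and z: "\<forall>j. binary_on (idx D j) (z j)"
      using p unfolding R_region_def eq by blast+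
    have "lam i \<in> {0..1}" for i
      using l by (cases "i \<in> midx D") (simp_all add: vec_on_def)
    moreover have "z i k \<in> {0..1}" for i k
      using binary_on_range[of "idx D i" "z i" k] z by auto
    ultimately show "p \<in> ?U"
      using common_constraints_unit_box[OF c] unfolding eq by blast
  qed
  ultimately show ?thesis
    by (rule compact_closed_subset)
qed

lemma continuous_R_cost: "continuous_on UNIV (R_cost D)"
  unfolding R_cost_def case_prod_beta by (intro continuous_cost continuous_entries)

lemma compact_P_fixed:
  assumes "closed (Xdom D)"
  shows "compact (P_fixed D z0 y0)"
proof -
  let ?U = "{f. \<forall>i k. f i k \<in> {0..1::real}} \<times> {f. \<forall>i. f i \<in> {0..1::real}}"
  have "compact ?U"
    by (intro compact_Times compact_unit_boxes)
  moreover have "closed (P_fixed D z0 y0)"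
  proof -
    have "P_fixed D z0 y0 = {p. (common_constraints D (fst p) (prod_weights (fst p)) (snd p) \<and>
        (\<forall>j. sos2 (idx D j) (fst p j))) \<and> (\<forall>l. snd p l = y0 l) \<and>
        (\<forall>j k. k \<in> idx D j \<longrightarrow> fst p j k \<le> z0 j k)}"
      by (auto simp: P_fixed_def P_region_def fun_eq_iff)
    also have "closed \<dots>"
      unfolding prod_weights_def
      by (intro closed_Collect_all closed_Collect_conj closed_Collect_imp closed_Collect_le
        closed_Collect_eq open_Collect_const closed_sos2
        closed_common_constraints assms continuous_entries continuous_intros finite_idx)
    finally show ?thesis .
  qed
  moreover have "P_fixed D z0 y0 \<subseteq> ?U"
    using common_constraints_unit_box unfolding P_fixed_def P_region_def by blast
  ultimately show ?thesis
    by (rule compact_closed_subset)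
qed

lemma continuous_P_cost: "continuous_on UNIV (P_cost D)"
  unfolding P_cost_def case_prod_beta prod_weights_def
  by (intro continuous_cost continuous_entries continuous_intros)

text \<open>Over a compact region a continuous cost leaves a solver only two kinds of correct answer,
  and one of them is always available.\<close>

lemma correct_answer_compact:
  fixes g :: "'a::topological_space \<Rightarrow> real"
  assumes "compact S" "continuous_on UNIV g"
  shows "correct_answer g S (sol, C) \<longleftrightarrow>
    (S = {} \<and> sol = None \<and> C = \<infinity>) \<or> (\<exists>s. sol = Some s \<and> minimizer g S s \<and> C = ereal (g s))"
    and "\<exists>r. correct_answer g S r"
proof -
  have "S = {} \<or> (\<exists>s. minimizer g S s)"
    using continuous_attains_inf[of S g] assms continuous_on_subset[of UNIV g S]
    unfolding minimizer_def by blast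
  moreover from this have "\<not> unbounded_problem g S"
    unfolding unbounded_problem_def minimizer_def by (meson empty_iff not_less)
  ultimately show "\<exists>r. correct_answer g S r"
    and "correct_answer g S (sol, C) \<longleftrightarrow>
    (S = {} \<and> sol = None \<and> C = \<infinity>) \<or> (\<exists>s. sol = Some s \<and> minimizer g S s \<and> C = ereal (g s))"
    unfolding correct_answer_def by auto
qed

lemma global_solver_correct:
  assumes "global_solver Q solve" "(g, S) \<in> Q" "solve g S r"
  shows "correct_answer g S r"
  using bspec[OF assms(1)[unfolded global_solver_def] assms(2)] assms(3)
  unfolding case_prod_conv by blast

lemma global_solver_answers:
  assumes "global_solver Q solve" "(g, S) \<in> Q" "\<exists>r. correct_answer g S r"
  shows "\<exists>r. solve g S r"
  using bspec[OF assms(1)[unfolded global_solver_def] assms(2)] assms(3)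
  unfolding case_prod_conv by blast

section \<open>From the problem to its relaxation\<close>

text \<open>Fixing \<open>k j = h\<close> leaves a product of sums over the other coordinates, each equal to 1.
  This is why the product constraints imply the marginal constraints that replace them.\<close>

lemma prod_weights_marginal:
  fixes xi :: "'n::finite xi"
  assumes "\<And>j. (\<Sum>k\<in>idx D j. xi j k) = 1" and "h \<in> idx D j"
  shows "(\<Sum>k\<in>{k\<in>midx D. k j = h}. prod_weights xi k) = xi j h"
proof -
  let ?B = "\<lambda>i. if i = j then {h} else idx D i"
  have "{k\<in>midx D. k j = h} = PiE UNIV ?B"
    using assms(2) by (auto simp: midx_def PiE_UNIV_domain Pi_iff split: if_splits)
  then have "(\<Sum>k\<in>{k\<in>midx D. k j = h}. prod_weights xi k) = (\<Prod>i\<in>UNIV. \<Sum>k\<in>?B i. xi i k)"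
    by (simp add: prod_weights_def prod_sum_PiE)
  also have "\<dots> = (\<Prod>i\<in>UNIV. if i = j then xi j h else 1)"
    using assms(1) by (intro prod.cong) auto
  finally show ?thesis by simp
qed

lemma ceil_unit: "x \<in> {0..1} \<Longrightarrow> (of_int \<lceil>x\<rceil> :: real) = (if x = 0 then 0 else 1)"
  by (auto intro!: ceiling_unique)

text \<open>For weights in \<open>[0, 1]\<close> the ceiling is the indicator of the support, so it inherits SOS2 from
  any \<open>z\<close> that is nonzero on the support.\<close>

lemma ceil_xi_binary_sos2:
  assumes "\<And>k. xi j k \<in> {0..1}" "vec_on (idx D j) (xi j)" "sos2 (idx D j) z"
    and "\<And>k. k \<in> idx D j \<Longrightarrow> z k = 0 \<Longrightarrow> xi j k = 0"
  shows "binary_on (idx D j) (ceil_xi xi j)" "sos2 (idx D j) (ceil_xi xi j)"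
proof -
  have c: "ceil_xi xi j k = (if xi j k = 0 then 0 else 1)" for k
    unfolding ceil_xi_def using ceil_unit[OF assms(1)] .
  show "binary_on (idx D j) (ceil_xi xi j)"
    using assms(2) by (auto simp: binary_on_def vec_on_def c)
  show "sos2 (idx D j) (ceil_xi xi j)"
    using assms(3) by (rule sos2_support_subset[rotated]) (use assms(4) in \<open>auto simp: c\<close>)
qed

text \<open>The product weights keep the cost unchanged, and the ceiling is the least binary vector
  that can accompany \<open>xi\<close>.\<close>

lemma lift_to_relaxation:
  assumes "(xi, y) \<in> P_region D" "\<forall>q\<in>set cuts. exclusion_cut D q (ceil_xi xi) y"
  shows "(xi, prod_weights xi, ceil_xi xi, y) \<in> R_region D cuts"
proof -
  have c: "common_constraints D xi (prod_weights xi) y" and s: "\<And>j. sos2 (idx D j) (xi j)"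
    using assms(1) by (auto simp: P_region_def)
  note u = common_constraints_unit_box(1)[OF c]
  have v: "\<And>j. vec_on (idx D j) (xi j)" and one: "\<And>j. (\<Sum>k\<in>idx D j. xi j k) = 1"
    using c by (auto simp: common_constraints_def)
  have "vec_on (midx D) (prod_weights xi)"
    unfolding vec_on_def
  proof (intro allI impI)
    fix k assume "k \<notin> midx D"
    then obtain j where "k j \<notin> idx D j" by (auto simp: midx_def)
    then have "xi j (k j) = 0" using v[of j] by (auto simp: vec_on_def)
    then show "prod_weights xi k = 0" unfolding prod_weights_def by auto
  qed
  moreover have "0 \<le> prod_weights xi k \<and> prod_weights xi k \<le> 1" for k
    using u unfolding prod_weights_def by (auto intro!: prod_nonneg prod_le_1)
  moreover have "xi j k \<le> ceil_xi xi j k" for j k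
    by (simp add: ceil_xi_def)
  ultimately show ?thesis
    using c assms(2) prod_weights_marginal[where D = D and xi = xi, OF one]
      ceil_xi_binary_sos2[of xi, OF u v s]
    unfolding R_region_def by simp
qed

section \<open>Exclusion cuts\<close>

text \<open>The pairs that can generate an exclusion cut.\<close>

definition cut_keys :: "('n::finite) minlp \<Rightarrow> ('n xi \<times> yvec) set" where
  "cut_keys D = {w. \<forall>j. binary_on (idx D j) (w j) \<and> sos2 (idx D j) (w j)} \<times>
     {y. binary_on {1..pnum D} y}"

lemma finite_binary_on:
  assumes "finite I"
  shows "finite {v. binary_on I v}"
proof -
  have "{v. binary_on I v} =
      {v. \<forall>k. (k \<in> I \<longrightarrow> v k \<in> {0, 1}) \<and> (k \<notin> I \<longrightarrow> v k = 0)}"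
    by (auto simp: binary_on_def vec_on_def)
  then show ?thesis
    using finite_set_of_finite_funs[OF assms, of "{0, 1::real}" 0] by simp
qed

lemma finite_cut_keys: "finite (cut_keys D)"
proof -
  have "finite (PiE UNIV (\<lambda>j. {v. binary_on (idx D j) v}))"
    by (intro finite_PiE finite_binary_on) auto
  moreover have "{w. \<forall>j. binary_on (idx D j) (w j) \<and> sos2 (idx D j) (w j)} \<subseteq>
      PiE UNIV (\<lambda>j. {v. binary_on (idx D j) v})"
    by (auto simp: PiE_UNIV_domain)
  ultimately show ?thesis
    unfolding cut_keys_def by (meson finite_SigmaI finite_subset finite_binary_on finite_atLeastAtMost)
qed

text \<open>On binary vectors each summand of the cut is 0 or 1: it is 1 exactly if \<open>z\<close> uses an entry that
  \<open>w\<close> forbids, or if \<open>y\<close> and \<open>y0\<close> differ.  The left-hand side thus counts violations of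
  \<open>z \<le> w\<close> and \<open>y = y0\<close>.\<close>

lemma exclusion_cut_binary_iff:
  assumes w: "\<And>j. binary_on (idx D j) (w j)" and v: "\<And>j. binary_on (idx D j) (z j)"
    and y: "binary_on {1..pnum D} y0" "binary_on {1..pnum D} y"
  shows "\<not> exclusion_cut D (w, y0) z y \<longleftrightarrow>
    (\<forall>j. \<forall>k\<in>idx D j. z j k \<le> w j k) \<and> y = y0"
proof -
  have t: "(1 - w j k) * z j k = real (of_bool (\<not> z j k \<le> w j k))" for j k
    using binary_on_range[OF w[of j], of k] binary_on_range[OF v[of j], of k] by auto
  have l: "y0 l * (1 - y l) + (1 - y0 l) * y l = real (of_bool (y0 l \<noteq> y l))" for l
    using binary_on_range[OF y(1), of l] binary_on_range[OF y(2), of l] by auto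
  \<comment> \<open>Counting in \<open>nat\<close> turns "less than 1" into "equal to 0".\<close>
  let ?N = "(\<Sum>j\<in>UNIV. \<Sum>k\<in>idx D j. of_bool (\<not> z j k \<le> w j k)) +
    (\<Sum>l=1..pnum D. of_bool (y0 l \<noteq> y l)) :: nat"
  have "exclusion_cut D (w, y0) z y \<longleftrightarrow> real ?N \<ge> 1"
    unfolding exclusion_cut_def by (simp only: t l of_nat_add of_nat_sum case_prod_conv)
  then have "\<not> exclusion_cut D (w, y0) z y \<longleftrightarrow> ?N = 0"
    by linarith
  also have "\<dots> \<longleftrightarrow> (\<forall>j. \<forall>k\<in>idx D j. z j k \<le> w j k) \<and> (\<forall>l\<in>{1..pnum D}. y0 l = y l)"
    by (simp only: add_is_0 sum_eq_0_iff finite finite_idx finite_atLeastAtMost of_bool_eq_0_iff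
        not_not ball_UNIV)
  also have "(\<forall>l\<in>{1..pnum D}. y0 l = y l) \<longleftrightarrow> y = y0"
    using y unfolding binary_on_def vec_on_def fun_eq_iff by metis
  finally show ?thesis .
qed

text \<open>Cuts discard no point of the problem that has not been examined: if the support of \<open>xi\<close> fails
  a cut, then \<open>xi\<close> lies below the vector \<open>w\<close> for which an NLP subproblem has been solved.\<close>

lemma cut_off_point_in_subproblem:
  assumes "(xi, y) \<in> P_region D" "(w, y0) \<in> cut_keys D"
    and "\<not> exclusion_cut D (w, y0) (ceil_xi xi) y"
  shows "(xi, y) \<in> P_fixed D w y0"
proof -
  have c: "common_constraints D xi (prod_weights xi) y" and s: "\<And>j. sos2 (idx D j) (xi j)"
    using assms(1) by (auto simp: P_region_def)
  have v: "\<And>j. vec_on (idx D j) (xi j)" and y: "binary_on {1..pnum D} y"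
    using c by (auto simp: common_constraints_def)
  have "(\<forall>j. \<forall>k\<in>idx D j. ceil_xi xi j k \<le> w j k) \<and> y = y0"
    using exclusion_cut_binary_iff[of D w "ceil_xi xi" y0 y] assms(2,3) y
      ceil_xi_binary_sos2[of xi, OF common_constraints_unit_box(1)[OF c] v s]
    by (auto simp: cut_keys_def)
  moreover have "xi j k \<le> ceil_xi xi j k" for j k
    by (simp add: ceil_xi_def)
  ultimately show ?thesis
    using assms(1) unfolding P_fixed_def by (blast intro: order_trans)
qed

text \<open>Progress.  The vector chosen for fixing satisfies the earlier cuts: if it is the ceiling, by the
  test made before choosing it, and if it is \<open>z\<close>, because \<open>z\<close> belongs to a feasible point of the
  relaxation.  No key satisfies its own cut, so the new key differs from all earlier ones.\<close>

lemma fix_vector_new_key: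
  assumes "(xi, lam, z, y) \<in> R_region D cuts"
  defines "w \<equiv> fix_vector D cuts (xi, lam, z, y)"
  assumes "set cuts \<subseteq> cut_keys D"
  shows "(w, y) \<in> cut_keys D - set cuts"
proof -
  have c: "common_constraints D xi lam y"
    and z: "\<And>j. binary_on (idx D j) (z j)" "\<And>j. sos2 (idx D j) (z j)"
    and le: "\<And>j k. k \<in> idx D j \<Longrightarrow> xi j k \<le> z j k"
    and q: "\<forall>q\<in>set cuts. exclusion_cut D q z y"
    using assms(1) by (auto simp: R_region_def)
  note u = common_constraints_unit_box(1)[OF c]
  have v: "\<And>j. vec_on (idx D j) (xi j)" and y: "binary_on {1..pnum D} y"
    using c by (auto simp: common_constraints_def)
  have zero: "xi j k = 0" if "k \<in> idx D j" "z j k = 0" for j k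
    using le[OF that(1)] u[of j k] that(2) by auto
  have key: "(w, y) \<in> cut_keys D"
    using y z ceil_xi_binary_sos2[of xi, OF u v z(2) zero]
    by (auto simp: cut_keys_def w_def fix_vector_def)
  have "exclusion_cut D q w y" if "q \<in> set cuts" for q
    using q that by (auto simp: w_def fix_vector_def)
  moreover have "\<not> exclusion_cut D (w, y) w y"
    using key exclusion_cut_binary_iff[of D w w y y] by (auto simp: cut_keys_def)
  ultimately show ?thesis
    using key by auto
qed

section \<open>Termination and correctness of the algorithm\<close>

text \<open>The last two conjuncts say that \<open>best_cost\<close> is a lower bound on every subproblem already excluded
  and that a finite \<open>best_cost\<close> is attained by the incumbent.  Distinct keys bound the number of
  iterations.\<close>

definition rfe_invariant :: "('n::finite) minlp \<Rightarrow> 'n rfe_state \<Rightarrow> bool" where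
  "rfe_invariant D s \<longleftrightarrow>
     correct_answer (R_cost D) (R_region D (cut_list s)) (relax_sol s, relax_cost s) \<and>
     set (cut_list s) \<subseteq> cut_keys D \<and> distinct (cut_list s) \<and>
     (\<forall>(w, y)\<in>set (cut_list s). \<forall>t\<in>P_fixed D w y. best_cost s \<le> ereal (P_cost D t)) \<and>
     (best_cost s = \<infinity> \<or>
       (\<exists>t\<in>P_region D. incumbent s = Some t \<and> best_cost s = ereal (P_cost D t)))"

locale rfe =
  fixes D :: "('n::finite) minlp"
    and milp :: "'n relax_point solver"
    and nlp :: "('n xi \<times> yvec) solver"
  assumes closed_Xdom: "closed (Xdom D)"
    and milp_solver: "global_solver (MILP_problems D) milp"
    and nlp_solver: "global_solver (NLP_problems D) nlp"
begin

lemmas relax_answer = correct_answer_compact[OF compact_R_region[OF closed_Xdom] continuous_R_cost[of D]]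
lemmas fixed_answer = correct_answer_compact[OF compact_P_fixed[OF closed_Xdom] continuous_P_cost[of D]]

lemma milp_correct:
  "milp (R_cost D) (R_region D cuts) r \<Longrightarrow> correct_answer (R_cost D) (R_region D cuts) r"
  using global_solver_correct[OF milp_solver] unfolding MILP_problems_def by blast

lemma milp_answers: "\<exists>r. milp (R_cost D) (R_region D cuts) r"
  using global_solver_answers[OF milp_solver _ relax_answer(2)[of cuts]]
  unfolding MILP_problems_def by blast

lemma nlp_problem:
  assumes "(w, y) \<in> cut_keys D"
  shows "(P_cost D, P_fixed D w y) \<in> NLP_problems D"
  using assms unfolding NLP_problems_def cut_keys_def by blast

lemma invariant_init: "rfe_init D milp s \<Longrightarrow> rfe_invariant D s"
  by (auto elim!: rfe_init.cases dest: milp_correct simp: rfe_invariant_def)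

text \<open>Taking the smaller of the two costs keeps the bound on the subproblems excluded earlier and
  extends it to the one just solved.\<close>

lemma invariant_step:
  assumes "rfe_step D milp nlp s s'" "rfe_invariant D s"
  shows "rfe_invariant D s'" "length (cut_list s') = Suc (length (cut_list s))"
proof -
  from assms(1) obtain xi lam z y w nsol Ctil C' inc' sol' Cbar' where
    sol: "relax_sol s = Some (xi, lam, z, y)"
    and w: "w = fix_vector D (cut_list s) (xi, lam, z, y)"
    and n: "nlp (P_cost D) (P_fixed D w y) (nsol, Ctil)"
    and upd: "(C', inc') = (if Ctil < best_cost s then (Ctil, nsol) else (best_cost s, incumbent s))"
    and m: "milp (R_cost D) (R_region D ((w, y) # cut_list s)) (sol', Cbar')"
    and s': "s' = \<lparr>best_cost = C', incumbent = inc', cut_list = (w, y) # cut_list s,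
                 relax_sol = sol', relax_cost = Cbar'\<rparr>"
    by (elim rfe_step.cases) blast
  have inv: "correct_answer (R_cost D) (R_region D (cut_list s)) (relax_sol s, relax_cost s)"
    "set (cut_list s) \<subseteq> cut_keys D" "distinct (cut_list s)"
    "\<And>w y t. (w, y) \<in> set (cut_list s) \<Longrightarrow> t \<in> P_fixed D w y \<Longrightarrow> best_cost s \<le> ereal (P_cost D t)"
    "best_cost s = \<infinity> \<or>
       (\<exists>t\<in>P_region D. incumbent s = Some t \<and> best_cost s = ereal (P_cost D t))"
    using assms(2) unfolding rfe_invariant_def by blast+
  have "(xi, lam, z, y) \<in> R_region D (cut_list s)"
    using inv(1) sol by (auto simp: relax_answer minimizer_def)
  then have key: "(w, y) \<in> cut_keys D - set (cut_list s)"
    unfolding w using inv(2) by (rule fix_vector_new_key)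
  have na: "P_fixed D w y = {} \<and> nsol = None \<and> Ctil = \<infinity> \<or>
     (\<exists>t. nsol = Some t \<and> minimizer (P_cost D) (P_fixed D w y) t \<and> Ctil = ereal (P_cost D t))"
    using global_solver_correct[OF nlp_solver nlp_problem n] key by (simp add: fixed_answer)
  have C': "C' \<le> best_cost s" "C' \<le> Ctil"
    using upd by (auto split: if_splits)
  have new: "C' \<le> ereal (P_cost D t)" if "t \<in> P_fixed D w y" for t
  proof -
    have "Ctil \<le> ereal (P_cost D t)"
      using na that by (auto simp: minimizer_def)
    then show ?thesis using C'(2) by (rule order_trans[rotated])
  qed
  have old: "C' \<le> ereal (P_cost D t)" if "(v, u) \<in> set (cut_list s)" "t \<in> P_fixed D v u" for v u t
    using inv(4)[OF that] C'(1) by (rule order_trans[rotated])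
  have inc: "C' = \<infinity> \<or> (\<exists>t\<in>P_region D. inc' = Some t \<and> C' = ereal (P_cost D t))"
  proof (cases "Ctil < best_cost s")
    case True
    then show ?thesis using upd na by (auto simp: minimizer_def P_fixed_def)
  next
    case False
    then show ?thesis using upd inv(5) by simp
  qed
  show "rfe_invariant D s'"
    unfolding rfe_invariant_def s'
    using milp_correct[OF m] key inv(2,3) new old inc by auto
  show "length (cut_list s') = Suc (length (cut_list s))"
    by (simp add: s')
qed

lemma invariant_reachable:
  assumes "rfe_reachable D milp nlp s"
  shows "rfe_invariant D s"
proof -
  from assms obtain s0 where "rfe_init D milp s0" "(rfe_step D milp nlp)\<^sup>*\<^sup>* s0 s"
    by (auto simp: rfe_reachable_def)
  from this(2,1) show ?thesis
    by (induction rule: rtranclp_induct) (auto intro: invariant_init invariant_step)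
qed

text \<open>A relaxation value below \<open>best_cost\<close> is not \<open>\<infinity>\<close>, so the relaxation comes with a minimizer; this is
  where a run could otherwise get stuck.\<close>

lemma step_exists:
  assumes "rfe_invariant D s" "loop_test s"
  shows "\<exists>s'. rfe_step D milp nlp s s'"
proof -
  have "relax_cost s \<noteq> \<infinity>"
    using assms(2) by (auto simp: loop_test_def)
  then obtain xi lam z y where sol: "relax_sol s = Some (xi, lam, z, y)"
    and R: "(xi, lam, z, y) \<in> R_region D (cut_list s)"
    using assms(1) by (auto simp: rfe_invariant_def relax_answer minimizer_def)
  define w where "w = fix_vector D (cut_list s) (xi, lam, z, y)"
  have "(w, y) \<in> cut_keys D"
    using fix_vector_new_key[OF R] assms(1) by (auto simp: w_def rfe_invariant_def)
  then obtain nsol Ctil where n: "nlp (P_cost D) (P_fixed D w y) (nsol, Ctil)"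
    using global_solver_answers[OF nlp_solver nlp_problem fixed_answer(2)] by force
  obtain sol' Cbar' where m: "milp (R_cost D) (R_region D ((w, y) # cut_list s)) (sol', Cbar')"
    using milp_answers by (metis surj_pair)
  obtain C' inc' where
    "(C', inc') = (if Ctil < best_cost s then (Ctil, nsol) else (best_cost s, incumbent s))"
    by (metis surj_pair)
  then show ?thesis
    using rfe_step.intros[where D = D and milp = milp and nlp = nlp and s = s,
        OF assms(2) sol w_def n _ refl m] by blast
qed

text \<open>Each step adds one key, and the keys are distinct elements of a finite set.\<close>

lemma no_infinite_run:
  assumes "rfe_init D milp (\<sigma> 0)" "\<And>t::nat. rfe_step D milp nlp (\<sigma> t) (\<sigma> (Suc t))"
  shows False
proof -
  have inv: "rfe_invariant D (\<sigma> t)" for t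
    by (induction t) (use assms in \<open>auto intro: invariant_init invariant_step\<close>)
  have len: "t \<le> length (cut_list (\<sigma> t))" for t
    by (induction t) (auto simp: invariant_step(2)[OF assms(2) inv])
  let ?T = "Suc (card (cut_keys D))"
  have "length (cut_list (\<sigma> ?T)) = card (set (cut_list (\<sigma> ?T)))"
    using inv[of ?T] by (auto simp: rfe_invariant_def distinct_card)
  also have "\<dots> \<le> card (cut_keys D)"
    using inv[of ?T] by (intro card_mono finite_cut_keys) (auto simp: rfe_invariant_def)
  finally show False using len[of ?T] by simp
qed

lemma terminates: "rfe_terminates D milp nlp"
proof -
  obtain sol Cbar where "milp (R_cost D) (R_region D []) (sol, Cbar)"
    using milp_answers by (metis surj_pair)
  then have "\<exists>s. rfe_init D milp s" using rfe_init.intros by blast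
  then show ?thesis
    unfolding rfe_terminates_def
    using no_infinite_run step_exists invariant_reachable by blast
qed

text \<open>Every feasible point either survives all cuts and is bounded by the relaxation, or is cut off and
  is bounded by the subproblem of the violated cut.\<close>

lemma best_cost_optimal:
  assumes "rfe_invariant D s" "\<not> loop_test s" "t \<in> P_region D"
  shows "best_cost s \<le> ereal (P_cost D t)"
proof -
  obtain xi y where t: "t = (xi, y)" by fastforce
  show ?thesis
  proof (cases "\<forall>q\<in>set (cut_list s). exclusion_cut D q (ceil_xi xi) y")
    case True
    then have R: "(xi, prod_weights xi, ceil_xi xi, y) \<in> R_region D (cut_list s)"
      using assms(3) t lift_to_relaxation by blast
    have "best_cost s \<le> relax_cost s"
      using assms(2) by (simp add: loop_test_def)
    also have "\<dots> \<le> ereal (R_cost D (xi, prod_weights xi, ceil_xi xi, y))"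
      using assms(1) R by (force simp: rfe_invariant_def relax_answer minimizer_def)
    finally show ?thesis by (simp add: t R_cost_def P_cost_def)
  next
    case False
    then obtain w y0 where q: "(w, y0) \<in> set (cut_list s)"
      "\<not> exclusion_cut D (w, y0) (ceil_xi xi) y" by fastforce
    then have "t \<in> P_fixed D w y0"
      using assms cut_off_point_in_subproblem t by (force simp: rfe_invariant_def)
    then show ?thesis
      using assms(1) q(1) by (force simp: rfe_invariant_def)
  qed
qed

lemma final_answer:
  assumes "rfe_invariant D s" "\<not> loop_test s"
  shows "(P_region D = {} \<and> rfe_return s = Value \<infinity>) \<or>
    (\<exists>xi y. minimizer (P_cost D) (P_region D) (xi, y) \<and> rfe_return s = Solution xi y)"
proof (cases "best_cost s = \<infinity>")
  case True
  then have "P_region D = {}"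
    using best_cost_optimal[OF assms] by fastforce
  then show ?thesis using True by (simp add: rfe_return_def)
next
  case False
  then obtain xi y where "(xi, y) \<in> P_region D" "incumbent s = Some (xi, y)"
    "best_cost s = ereal (P_cost D (xi, y))"
    using assms(1) by (auto simp: rfe_invariant_def)
  then show ?thesis
    using best_cost_optimal[OF assms] by (auto simp: minimizer_def rfe_return_def)
qed

end

theorem theorem1:
  fixes D :: "('n::finite) minlp"
    and milp :: "'n relax_point solver"
    and nlp :: "('n xi \<times> yvec) solver"
  assumes "valid_data D"
    and "global_solver (MILP_problems D) milp"
    and "global_solver (NLP_problems D) nlp"
  shows "rfe_terminates D milp nlp \<and>
    (\<forall>s. rfe_reachable D milp nlp s \<and> \<not> loop_test s \<longrightarrow>
       (P_region D = {} \<and> rfe_return s = Value \<infinity>) \<or>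
       (unbounded_problem (P_cost D) (P_region D) \<and> rfe_return s = Value (-\<infinity>)) \<or>
       (\<exists>xi y. minimizer (P_cost D) (P_region D) (xi, y) \<and> rfe_return s = Solution xi y))"
proof -
  interpret rfe D milp nlp
    using assms by unfold_locales (auto simp: valid_data_def polyhedron_imp_closed)
  show ?thesis
    using terminates final_answer[OF invariant_reachable] by blast
qed

end
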